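(* Let $N\ge 2$, $h=1/N$, $x_j=jh$. The discrete operator $(\delta_x^4)^{-1}:l^2_{h,0}\to l^2_{h,0}$ is represented by the matrix $\{K^h_{i,j}\}_{1\le i,j\le N-1}$ given explicitly by $$K^h_{i,j}=h\,K(x_i,x_j),\qquad 1\le i,j\le N-1,$$ where $K(x,y)$ is the resolvent kernel (Green's function) of $\big(\frac{d}{dx}\big)^4$ on $[0,1]$ with homogeneous boundary conditions $u(0)=u'(0)=u(1)=u'(1)=0$, namely $$K(x,y)=\begin{cases}\frac16(1-x)^2y^2\,[2x(1-y)+x-y], & y<x,\\[2pt] \frac16x^2(1-y)^2\,[2y(1-x)+y-x], & x<y,\end{cases}$$ extended continuously to the diagonal $x=y$. That is, for $\mathfrak{f}\in l^2_{h,0}$ the solution $\mathfrak{u}\in l^2_{h,0}$ of $\delta_x^4\mathfrak{u}=\mathfrak{f}$ is $\mathfrak{u}_i=\sum_{j=1}^{N-1}K^h_{i,j}\mathfrak{f}_j$, $1\le i\le N-1$.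
   Context: The grid on $[0,1]$ is $x_j=jh$, $0\le j\le N$. A grid function is a vector $\mathfrak{v}=(\mathfrak{v}_j)_{j=0}^N$; $l^2_{h,0}$ is the space of grid functions with $\mathfrak{v}_0=\mathfrak{v}_N=0$. Finite differences, for $1\le j\le N-1$: $(\delta_x\mathfrak{v})_j=\frac{\mathfrak{v}_{j+1}-\mathfrak{v}_{j-1}}{2h}$ and $(\delta_x^2\mathfrak{v})_j=\frac{\mathfrak{v}_{j+1}-2\mathfrak{v}_j+\mathfrak{v}_{j-1}}{h^2}$. Hermitian derivative: for $\mathfrak{u}\in l^2_{h,0}$, $\mathfrak{u}_x$ is the unique element of $l^2_{h,0}$ with $\tfrac16(\mathfrak{u}_x)_{j-1}+\tfrac23(\mathfrak{u}_x)_j+\tfrac16(\mathfrak{u}_x)_{j+1}=(\delta_x\mathfrak{u})_j$ for $1\le j\le N-1$. Discrete biharmonic operator: $$(\delta_x^4\mathfrak{u})_j=\frac{12}{h^2}\big[(\delta_x\mathfrak{u}_x)_j-(\delta_x^2\mathfrak{u})_j\big],\qquad 1\le j\le N-1,$$ with $\delta_x^4\mathfrak{u}$ regarded as an element of $l^2_{h,0}$ (endpoint values $0$). It is known that $\delta_x^4$ is symmetric and positive definite on $l^2_{h,0}$, hence invertible there. *)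

theory Defs
  imports "HOL-Analysis.Analysis"
begin

(* Grid functions are maps nat => real. Only the indices 0..N carry information; membership in
   l2h0 N forces the value 0 beyond N, so that equality of functions in l2h0 N is equality
   of vectors (v_0, ..., v_N) with v_0 = v_N = 0. *)

definition l2h0 :: "nat \<Rightarrow> (nat \<Rightarrow> real) set" where
  "l2h0 N = {v. v 0 = 0 \<and> (\<forall>j\<ge>N. v j = 0)}"

definition mesh :: "nat \<Rightarrow> real" where
  "mesh N = 1 / real N"

definition gridpt :: "nat \<Rightarrow> nat \<Rightarrow> real" where
  "gridpt N j = real j * mesh N"

(* The two difference quotients are only meaningful, and only used, for 1 <= j <= N - 1;
   at j = 0 the index j - 1 is truncated. *)

definition delta_x :: "nat \<Rightarrow> (nat \<Rightarrow> real) \<Rightarrow> nat \<Rightarrow> real" where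
  "delta_x N v j = (v (j + 1) - v (j - 1)) / (2 * mesh N)"

definition delta_x2 :: "nat \<Rightarrow> (nat \<Rightarrow> real) \<Rightarrow> nat \<Rightarrow> real" where
  "delta_x2 N v j = (v (j + 1) - 2 * v j + v (j - 1)) / (mesh N)\<^sup>2"

definition hermitian_deriv :: "nat \<Rightarrow> (nat \<Rightarrow> real) \<Rightarrow> nat \<Rightarrow> real" where
  "hermitian_deriv N u = (THE w. w \<in> l2h0 N \<and>
     (\<forall>j\<in>{1..N - 1}. 1/6 * w (j - 1) + 2/3 * w j + 1/6 * w (j + 1) = delta_x N u j))"

definition delta_x4 :: "nat \<Rightarrow> (nat \<Rightarrow> real) \<Rightarrow> nat \<Rightarrow> real" where
  "delta_x4 N u = (\<lambda>j. if j \<in> {1..N - 1}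
     then 12 / (mesh N)\<^sup>2 * (delta_x N (hermitian_deriv N u) j - delta_x2 N u j)
     else 0)"

(* The two branches agree on the diagonal, so putting x = y into the first one is the
   continuous extension. *)

definition clamped_kernel :: "real \<Rightarrow> real \<Rightarrow> real" where
  "clamped_kernel x y =
     (if y \<le> x then 1/6 * (1 - x)\<^sup>2 * y\<^sup>2 * (2 * x * (1 - y) + x - y)
      else 1/6 * x\<^sup>2 * (1 - y)\<^sup>2 * (2 * y * (1 - x) + y - x))"

definition solves_clamped :: "(real \<Rightarrow> real) \<Rightarrow> (real \<Rightarrow> real) \<Rightarrow> bool" where
  "solves_clamped f u \<longleftrightarrow> (\<exists>u1 u2 u3.
     (\<forall>x\<in>{0..1}.
        (u has_real_derivative u1 x) (at x within {0..1}) \<and>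
        (u1 has_real_derivative u2 x) (at x within {0..1}) \<and>
        (u2 has_real_derivative u3 x) (at x within {0..1}) \<and>
        (u3 has_real_derivative f x) (at x within {0..1})) \<and>
     u 0 = 0 \<and> u1 0 = 0 \<and> u 1 = 0 \<and> u1 1 = 0)"

(* G is the continuous kernel of the inverse of (d/dx)^4 on [0,1] with clamped boundary
   conditions; the equivalence gives both existence and uniqueness of the solution. *)

definition is_resolvent_kernel :: "(real \<Rightarrow> real \<Rightarrow> real) \<Rightarrow> bool" where
  "is_resolvent_kernel G \<longleftrightarrow>
     continuous_on ({0..1} \<times> {0..1}) (\<lambda>(x, y). G x y) \<and>
     (\<forall>f u. continuous_on {0..1} f \<longrightarrow>
        (solves_clamped f u \<longleftrightarrow>
           (\<forall>x\<in>{0..1}. u x = integral {0..1} (\<lambda>y. G x y * f y))))"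

definition Kh :: "nat \<Rightarrow> nat \<Rightarrow> nat \<Rightarrow> real" where
  "Kh N i j = mesh N * clamped_kernel (gridpt N i) (gridpt N j)"

end

theory Submission
  imports Defs
begin

text \<open>
  Both halves of the theorem rest on one decomposition: for fixed \<open>y\<close> the kernel is a cubic
  \<open>a x\<^sup>2 + b x\<^sup>3\<close> plus the truncated power \<open>(x - y)\<^sub>+\<^sup>3 / 6\<close>
  (\<open>clamped_kernel_split\<close>). The cubic makes the kernel and its slope vanish at \<open>1\<close>, and the
  truncated power carries the unit jump of the third derivative.

  \<^emph>\<open>Continuous problem.\<close> The integral of \<open>(x - y)\<^sub>+\<^sup>3 / 6\<close> against \<open>f\<close> is the fourfold
  antiderivative of \<open>f\<close>, and the cubic parts integrate to a cubic, so the kernel integral solves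
  the boundary value problem (\<open>clamped_kernel_integral_solves\<close>). The difference
  of two solutions has vanishing fourth derivative, so it is a cubic, and a cubic with double zeros at \<open>0\<close> and \<open>1\<close> vanishes
  (\<open>solves_clamped_unique\<close>).

  \<^emph>\<open>Discrete problem.\<close> The Hermitian derivative relation is Simpson's rule for \<open>u'\<close> on
  \<open>[x\<^sub>j\<^sub>-\<^sub>1, x\<^sub>j\<^sub>+\<^sub>1]\<close>. It is exact for cubics, and also for truncated powers whose knot is a grid
  point: a knot at the midpoint is handled correctly by symmetry. Hence the Hermitian derivative of
  a column of the kernel is its true \<open>x\<close>-derivative on the grid, and there the discrete biharmonic
  operator yields \<open>0\<close> away from the knot and \<open>1 / h\<close> at the knot
  (\<open>clamped_kernel_column_stencils\<close>). Superposition gives a right inverse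
  (\<open>delta_x4_kernel_sum\<close>). Injectivity is the discrete copy of the uniqueness argument: the
  two stencils form a recurrence for the pair of value and slope which determines the pair at \<open>x\<^sub>j\<^sub>+\<^sub>1\<close> from the two
  previous ones; cubics satisfy it, so a null vector is the restriction of a cubic with double zeros
  at \<open>0\<close> and \<open>1\<close> (\<open>discrete_biharmonic_null\<close>).
\<close>

section \<open>Truncated powers and the clamped kernel\<close>

text \<open>The partial derivative of \<open>clamped_kernel\<close> in \<open>x\<close>, for every \<open>x\<close> including the diagonal: it is
  the termwise derivative of the decomposition in \<open>clamped_kernel_split\<close>.\<close>

definition clamped_kernel_dx :: "real \<Rightarrow> real \<Rightarrow> real" where
  "clamped_kernel_dx x y = 2 * ((1 - y)\<^sup>2 * y / 2) * x - 3 * ((1 - y)\<^sup>2 * (1 + 2 * y) / 6) * x\<^sup>2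
     + (max 0 (x - y))\<^sup>2 / 2"

text \<open>The two branches of the kernel differ by exactly \<open>(x - y)\<^sup>3 / 6\<close>, so the cubic below is the
  branch for \<open>x < y\<close>.\<close>

lemma clamped_kernel_split:
  "clamped_kernel x y =
     (1 - y)\<^sup>2 * y / 2 * x\<^sup>2 - (1 - y)\<^sup>2 * (1 + 2 * y) / 6 * x ^ 3 + (max 0 (x - y)) ^ 3 / 6"
  unfolding clamped_kernel_def max_def
  by (auto simp: field_simps power2_eq_square power3_eq_cube)

lemma clamped_kernel_boundary:
  assumes "0 \<le> y" "y \<le> 1"
  shows "clamped_kernel 0 y = 0" "clamped_kernel 1 y = 0"
    "clamped_kernel_dx 0 y = 0" "clamped_kernel_dx 1 y = 0"
proof -
  have "max 0 (0 - y) = 0" "max 0 (1 - y) = 1 - y"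
    using assms by simp_all
  then show "clamped_kernel 0 y = 0" "clamped_kernel 1 y = 0"
    "clamped_kernel_dx 0 y = 0" "clamped_kernel_dx 1 y = 0"
    unfolding clamped_kernel_split clamped_kernel_dx_def
    by (simp_all add: field_simps power2_eq_square power3_eq_cube)
qed

lemma continuous_on_clamped_kernel:
  "continuous_on S (\<lambda>(x, y). clamped_kernel x y)"
  unfolding clamped_kernel_split case_prod_beta by (intro continuous_intros) auto

section \<open>The continuous boundary value problem\<close>

lemma moment_has_derivative:
  fixes f :: "real \<Rightarrow> real"
  assumes "continuous_on {0..1} f" "x \<in> {0..1}"
  shows "((\<lambda>x. integral {0..x} (\<lambda>y. y ^ k * f y)) has_real_derivative x ^ k * f x)
           (at x within {0..1})"
  using assms by (intro integral_has_real_derivative continuous_intros) auto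

text \<open>Expanding \<open>(x - y)\<^sup>3\<close> turns the fourfold antiderivative of \<open>f\<close> into a combination of moments,
  each of which the fundamental theorem of calculus differentiates.\<close>

lemma integral_truncated_cube:
  fixes f :: "real \<Rightarrow> real"
  assumes f: "continuous_on {0..1} f" and x: "x \<in> {0..1}"
  shows "integral {0..1} (\<lambda>y. (max 0 (x - y)) ^ 3 / 6 * f y) =
     (x ^ 3 * integral {0..x} f - 3 * x\<^sup>2 * integral {0..x} (\<lambda>y. y * f y)
      + 3 * x * integral {0..x} (\<lambda>y. y\<^sup>2 * f y) - integral {0..x} (\<lambda>y. y ^ 3 * f y)) / 6"
proof -
  have fx: "continuous_on {0..x} f"
    using f x by (auto intro: continuous_on_subset)
  have int: "(\<lambda>y. y ^ k * f y) integrable_on {0..x}" for k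
    by (intro integrable_continuous_real continuous_intros fx)
  have "integral {0..1} (\<lambda>y. (max 0 (x - y)) ^ 3 / 6 * f y) =
      integral {0..x} (\<lambda>y. (max 0 (x - y)) ^ 3 / 6 * f y)
      + integral {x..1} (\<lambda>y. (max 0 (x - y)) ^ 3 / 6 * f y)"
    using x by (intro Henstock_Kurzweil_Integration.integral_combine [symmetric]
        integrable_continuous_real continuous_intros f) auto
  also have "integral {x..1} (\<lambda>y. (max 0 (x - y)) ^ 3 / 6 * f y) = integral {x..1} (\<lambda>y. 0)"
    by (intro integral_cong) (auto simp: max_def)
  also have "integral {0..x} (\<lambda>y. (max 0 (x - y)) ^ 3 / 6 * f y) =
      integral {0..x} (\<lambda>y. x ^ 3 / 6 * (y ^ 0 * f y) - x\<^sup>2 / 2 * (y ^ 1 * f y)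
        + x / 2 * (y\<^sup>2 * f y) - 1 / 6 * (y ^ 3 * f y))"
    by (intro integral_cong)
      (auto simp: max_def field_simps power2_eq_square power3_eq_cube)
  also have "\<dots> = x ^ 3 / 6 * integral {0..x} (\<lambda>y. y ^ 0 * f y)
      - x\<^sup>2 / 2 * integral {0..x} (\<lambda>y. y ^ 1 * f y)
      + x / 2 * integral {0..x} (\<lambda>y. y\<^sup>2 * f y) - 1 / 6 * integral {0..x} (\<lambda>y. y ^ 3 * f y)"
    by (intro integral_unique has_integral_diff has_integral_add has_integral_mult_right
        integrable_integral int)
  finally show ?thesis
    by (simp add: field_simps)
qed

lemma clamped_kernel_integral_solves:
  fixes f :: "real \<Rightarrow> real"
  assumes f: "continuous_on {0..1} f"
  shows "solves_clamped f (\<lambda>x. integral {0..1} (\<lambda>y. clamped_kernel x y * f y))"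
proof -
  define M where "M k x = integral {0..x} (\<lambda>y. y ^ k * f y)" for k :: nat and x
  define a where "a = integral {0..1} (\<lambda>y. (1 - y)\<^sup>2 * y / 2 * f y)"
  define b where "b = integral {0..1} (\<lambda>y. (1 - y)\<^sup>2 * (1 + 2 * y) / 6 * f y)"
  \<comment> \<open>The derivatives lose the boundary terms \<open>x\<^sup>k f x\<close> of the moments, since these recombine to
    powers of \<open>x - x\<close>; only the last one leaves \<open>f\<close>.\<close>
  define U where "U x = a * x\<^sup>2 - b * x ^ 3
      + (x ^ 3 * M 0 x - 3 * x\<^sup>2 * M 1 x + 3 * x * M 2 x - M 3 x) / 6" for x
  define U1 where "U1 x = 2 * a * x - 3 * b * x\<^sup>2
      + (x\<^sup>2 * M 0 x - 2 * x * M 1 x + M 2 x) / 2" for x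
  define U2 where "U2 x = 2 * a - 6 * b * x + (x * M 0 x - M 1 x)" for x
  define U3 where "U3 x = - 6 * b + M 0 x" for x
  have dM: "(M k has_real_derivative x ^ k * f x) (at x within {0..1})" if "x \<in> {0..1}" for k x
    unfolding M_def using f that by (rule moment_has_derivative)
  have U: "integral {0..1} (\<lambda>y. clamped_kernel x y * f y) = U x" if "x \<in> {0..1}" for x
  proof -
    have "integral {0..1} (\<lambda>y. clamped_kernel x y * f y) =
      integral {0..1} (\<lambda>y. x\<^sup>2 * ((1 - y)\<^sup>2 * y / 2 * f y)
         - x ^ 3 * ((1 - y)\<^sup>2 * (1 + 2 * y) / 6 * f y) + (max 0 (x - y)) ^ 3 / 6 * f y)"
      unfolding clamped_kernel_split by (intro integral_cong) (simp add: algebra_simps)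
    also have "\<dots> = x\<^sup>2 * a - x ^ 3 * b + integral {0..1} (\<lambda>y. (max 0 (x - y)) ^ 3 / 6 * f y)"
      unfolding a_def b_def
      by (intro integral_unique has_integral_diff has_integral_add has_integral_mult_right
        integrable_integral integrable_continuous_real continuous_intros f) auto
    finally show ?thesis
      using integral_truncated_cube [OF f that] by (simp add: U_def M_def mult.commute)
  qed
  have d: "(U has_real_derivative U1 x) (at x within {0..1})"
    "(U1 has_real_derivative U2 x) (at x within {0..1})"
    "(U2 has_real_derivative U3 x) (at x within {0..1})"
    "(U3 has_real_derivative f x) (at x within {0..1})" if "x \<in> {0..1}" for x
    unfolding U_def U1_def U2_def U3_def
    by (auto intro!: derivative_eq_intros dM that
        simp: field_simps power2_eq_square power3_eq_cube)
  have "integral {0..1} (\<lambda>y. clamped_kernel 1 y * f y) = integral {0..1} (\<lambda>y::real. 0)"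
    "integral {0..1} (\<lambda>y. clamped_kernel_dx 1 y * f y) = integral {0..1} (\<lambda>y::real. 0)"
    by (rule integral_cong, simp add: clamped_kernel_boundary)+
  moreover
  \<comment> \<open>On \<open>[0,1]\<close> the truncation at \<open>x = 1\<close> is inactive, so all integrands are polynomials times \<open>f\<close>.\<close>
  have "integral {0..1} (\<lambda>y. clamped_kernel_dx 1 y * f y) =
      integral {0..1} (\<lambda>y. 2 * ((1 - y)\<^sup>2 * y / 2 * f y) - 3 * ((1 - y)\<^sup>2 * (1 + 2 * y) / 6 * f y)
        + 1 / 2 * (y ^ 0 * f y) - (y ^ 1 * f y) + 1 / 2 * (y\<^sup>2 * f y))"
    by (intro integral_cong)
      (auto simp: clamped_kernel_dx_def max_def field_simps power2_eq_square)
  moreover have "\<dots> = 2 * a - 3 * b + 1 / 2 * M 0 1 - M 1 1 + 1 / 2 * M 2 1"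
    unfolding a_def b_def M_def
    by (intro integral_unique has_integral_diff has_integral_add has_integral_mult_right
        integrable_integral integrable_continuous_real continuous_intros f) auto
  ultimately have "U 1 = 0" "U1 1 = 0"
    using U [of 1] by (simp_all add: U1_def add_divide_distrib diff_divide_distrib)
  moreover have "U 0 = 0" "U1 0 = 0"
    by (simp_all add: U_def U1_def M_def)
  moreover have "((\<lambda>x. integral {0..1} (\<lambda>y. clamped_kernel x y * f y)) has_real_derivative U1 x)
      (at x within {0..1})" if "x \<in> {0..1}" for x
    using d(1) [OF that] by (rule has_field_derivative_transform_within [where d = 1]) (use that U in auto)
  ultimately show ?thesis
    unfolding solves_clamped_def using d(2-4) U
    by (intro exI [of _ U1] exI [of _ U2] exI [of _ U3]) auto
qed

lemma same_derivative_imp_const_diff: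
  fixes u v :: "real \<Rightarrow> real"
  assumes "\<And>x. x \<in> {0..1} \<Longrightarrow> (u has_real_derivative g x) (at x within {0..1})"
    and "\<And>x. x \<in> {0..1} \<Longrightarrow> (v has_real_derivative g x) (at x within {0..1})"
  obtains c where "\<And>x. x \<in> {0..1} \<Longrightarrow> u x = v x + c"
proof -
  have "((\<lambda>x. u x - v x) has_field_derivative 0) (at x within {0..1})" if "x \<in> {0..1}" for x
    using DERIV_diff [OF assms [OF that]] by simp
  then obtain c where "\<And>x. x \<in> {0..1} \<Longrightarrow> u x - v x = c"
    using has_field_derivative_zero_constant [of "{0..1::real}" "\<lambda>x. u x - v x"] by auto
  then show ?thesis
    by (intro that [of c]) (auto simp: algebra_simps)
qed

text \<open>The difference of two solutions is a cubic with double zeros at both endpoints.\<close>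

lemma solves_clamped_unique:
  assumes "solves_clamped f u" "solves_clamped f v" "x \<in> {0..1}"
  shows "u x = v x"
proof -
  let ?I = "{0..1::real}"
  obtain u1 u2 u3 where u: "\<And>x. x \<in> ?I \<Longrightarrow> (u has_real_derivative u1 x) (at x within ?I)"
      "\<And>x. x \<in> ?I \<Longrightarrow> (u1 has_real_derivative u2 x) (at x within ?I)"
      "\<And>x. x \<in> ?I \<Longrightarrow> (u2 has_real_derivative u3 x) (at x within ?I)"
      "\<And>x. x \<in> ?I \<Longrightarrow> (u3 has_real_derivative f x) (at x within ?I)"
      and u0: "u 0 = 0" "u1 0 = 0" "u 1 = 0" "u1 1 = 0"
    using assms(1) unfolding solves_clamped_def by blast
  obtain v1 v2 v3 where v: "\<And>x. x \<in> ?I \<Longrightarrow> (v has_real_derivative v1 x) (at x within ?I)"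
      "\<And>x. x \<in> ?I \<Longrightarrow> (v1 has_real_derivative v2 x) (at x within ?I)"
      "\<And>x. x \<in> ?I \<Longrightarrow> (v2 has_real_derivative v3 x) (at x within ?I)"
      "\<And>x. x \<in> ?I \<Longrightarrow> (v3 has_real_derivative f x) (at x within ?I)"
      and v0: "v 0 = 0" "v1 0 = 0" "v 1 = 0" "v1 1 = 0"
    using assms(2) unfolding solves_clamped_def by blast
  obtain c3 where c3: "\<And>x. x \<in> ?I \<Longrightarrow> u3 x = v3 x + c3"
    using same_derivative_imp_const_diff [OF u(4) v(4)] by blast
  have "((\<lambda>x. v2 x + c3 * x) has_real_derivative u3 x) (at x within ?I)" if "x \<in> ?I" for x
    using that by (auto intro!: derivative_eq_intros v simp: c3)
  then obtain c2 where c2: "\<And>x. x \<in> ?I \<Longrightarrow> u2 x = v2 x + c3 * x + c2"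
    using same_derivative_imp_const_diff [OF u(3)] by blast
  have "((\<lambda>x. v1 x + (c3 * x\<^sup>2 / 2 + c2 * x)) has_real_derivative u2 x) (at x within ?I)"
    if "x \<in> ?I" for x
    using that by (auto intro!: derivative_eq_intros v simp: c2)
  then obtain c1 where c1: "\<And>x. x \<in> ?I \<Longrightarrow> u1 x = v1 x + (c3 * x\<^sup>2 / 2 + c2 * x) + c1"
    using same_derivative_imp_const_diff [OF u(2)] by blast
  have "c1 = 0" "c3 / 2 + c2 = 0"
    using c1 [of 0] c1 [of 1] u0 v0 by simp_all
  then have "((\<lambda>x. v x + (c3 * x ^ 3 / 6 + c2 * x\<^sup>2 / 2)) has_real_derivative u1 x) (at x within ?I)"
    if "x \<in> ?I" for x
    using that by (auto intro!: derivative_eq_intros v simp: c1 field_simps power2_eq_square)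
  then obtain c0 where c0: "\<And>x. x \<in> ?I \<Longrightarrow> u x = v x + (c3 * x ^ 3 / 6 + c2 * x\<^sup>2 / 2) + c0"
    using same_derivative_imp_const_diff [OF u(1)] by blast
  have "c0 = 0" "c3 / 6 + c2 / 2 = 0"
    using c0 [of 0] c0 [of 1] u0 v0 by simp_all
  with \<open>c3 / 2 + c2 = 0\<close> have "c3 = 0" "c2 = 0"
    by linarith+
  then show ?thesis
    using c0 [OF assms(3)] \<open>c0 = 0\<close> by simp
qed

lemma solves_clamped_cong:
  assumes "solves_clamped f u" "\<And>x. x \<in> {0..1} \<Longrightarrow> v x = u x"
  shows "solves_clamped f v"
proof -
  have "(v has_real_derivative d) (at x within {0..1})"
    if "(u has_real_derivative d) (at x within {0..1})" "x \<in> {0..1}" for d x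
    using that(1) by (rule has_field_derivative_transform_within [where d = 1])
      (use that assms(2) in auto)
  moreover have "v 0 = u 0" "v 1 = u 1"
    by (simp_all add: assms(2))
  ultimately show ?thesis
    using assms(1) unfolding solves_clamped_def by (metis (no_types, lifting))
qed

theorem clamped_kernel_is_resolvent_kernel: "is_resolvent_kernel clamped_kernel"
  unfolding is_resolvent_kernel_def
  using continuous_on_clamped_kernel clamped_kernel_integral_solves
    solves_clamped_unique solves_clamped_cong
  by blast

section \<open>The Hermitian derivative\<close>

text \<open>The Hermitian derivative as a relation: unlike the definite description it is visibly linear in
  the pair, and \<open>p\<close> can be exhibited and then recognised by uniqueness.\<close>

definition hermitian_pair :: "nat \<Rightarrow> (nat \<Rightarrow> real) \<Rightarrow> (nat \<Rightarrow> real) \<Rightarrow> bool" where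
  "hermitian_pair N u p \<longleftrightarrow> p \<in> l2h0 N \<and>
     (\<forall>j\<in>{1..N - 1}. 1/6 * p (j - 1) + 2/3 * p j + 1/6 * p (j + 1) = delta_x N u j)"

text \<open>Solving the tridiagonal system of the Hermitian derivative by shooting from the left end with
  initial slope \<open>t\<close>.\<close>

fun shoot :: "(nat \<Rightarrow> real) \<Rightarrow> real \<Rightarrow> nat \<Rightarrow> real" where
  "shoot d t 0 = 0"
| "shoot d t (Suc 0) = t"
| "shoot d t (Suc (Suc n)) = 6 * d (Suc n) - 4 * shoot d t (Suc n) - shoot d t n"

lemma shoot_affine: "shoot d t n = shoot d 0 n + t * shoot (\<lambda>_. 0) 1 n"
  by (induction d t n rule: shoot.induct) (auto simp: algebra_simps)

text \<open>Diagonal dominance makes the homogeneous solution grow, so it never returns to zero and the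
  slope can be chosen to hit any value at the right end.\<close>

lemma shoot_homogeneous_nonzero: "shoot (\<lambda>_. 0) 1 (Suc n) \<noteq> 0"
proof -
  have "\<bar>shoot (\<lambda>_. 0) 1 n\<bar> < \<bar>shoot (\<lambda>_. 0) 1 (Suc n)\<bar>"
    by (induction n) auto
  then show ?thesis by auto
qed

lemma tridiagonal_eq_shoot:
  assumes "p 0 = 0" "\<And>j. j \<in> {1..N - 1} \<Longrightarrow> 1/6 * p (j - 1) + 2/3 * p j + 1/6 * p (j + 1) = d j"
    and "n \<le> N"
  shows "p n = shoot d (p 1) n"
  using assms(3)
proof (induction n rule: induct_nat_012)
  case (ge2 n)
  then have "1/6 * p n + 2/3 * p (Suc n) + 1/6 * p (Suc (Suc n)) = d (Suc n)"
    using assms(2) [of "Suc n"] by simp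
  with ge2 show ?case by simp
qed (use assms(1) in auto)

lemma ex1_hermitian_pair:
  assumes "N \<ge> 2"
  shows "\<exists>!p. hermitian_pair N u p"
proof -
  define d where "d = delta_x N u"
  define z where "z = shoot (\<lambda>_. 0) 1"
  have z: "z N \<noteq> 0"
    using assms shoot_homogeneous_nonzero [of "N - 1"] by (simp add: z_def)
  define t where "t = - shoot d 0 N / z N"
  have hit: "shoot d s N = 0 \<longleftrightarrow> s = t" for s
    using z shoot_affine [of d s N] by (auto simp: t_def z_def [symmetric] field_simps)
  define p where "p n = (if n < N then shoot d t n else 0)" for n
  have p: "p n = shoot d t n" if "n \<le> N" for n
    using that hit [of t] by (auto simp: p_def le_less)
  have "1/6 * p (j - 1) + 2/3 * p j + 1/6 * p (j + 1) = d j" if j: "j \<in> {1..N - 1}" for j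
  proof -
    obtain n where n: "j = Suc n" "Suc (Suc n) \<le> N"
      using j by (cases j) auto
    show ?thesis
      using n by (simp add: p field_simps)
  qed
  moreover have "p \<in> l2h0 N"
    by (auto simp: l2h0_def p_def)
  ultimately have "hermitian_pair N u p"
    by (simp add: hermitian_pair_def d_def)
  moreover have "q = p" if "hermitian_pair N u q" for q
  proof -
    have q: "q n = shoot d (q 1) n" if "n \<le> N" for n
      using \<open>hermitian_pair N u q\<close> that
      by (intro tridiagonal_eq_shoot) (auto simp: hermitian_pair_def l2h0_def d_def)
    have q0: "q n = 0" if "n \<ge> N" for n
      using \<open>hermitian_pair N u q\<close> that by (auto simp: hermitian_pair_def l2h0_def)
    have "q 1 = t"
      using q [of N] q0 [of N] hit by simp
    then show "q = p"
      using q q0 by (intro ext) (simp add: p_def)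
  qed
  ultimately show ?thesis by blast
qed

lemma hermitian_deriv_eq:
  assumes "N \<ge> 2" "hermitian_pair N u p"
  shows "hermitian_deriv N u = p"
  unfolding hermitian_deriv_def hermitian_pair_def [symmetric]
  by (rule the1_equality [OF ex1_hermitian_pair]) (use assms in auto)

lemma hermitian_pair_hermitian_deriv:
  assumes "N \<ge> 2"
  shows "hermitian_pair N u (hermitian_deriv N u)"
  unfolding hermitian_deriv_def hermitian_pair_def [symmetric]
  by (rule theI' [OF ex1_hermitian_pair [OF assms]])

section \<open>Injectivity of the discrete operator\<close>

text \<open>With the slopes scaled by \<open>h\<close>, the two stencils determine \<open>(u\<^sub>n, p\<^sub>n)\<close> from the two
  preceding pairs, and every cubic satisfies them; so the solution is the cubic
  \<open>a n\<^sup>2 + b n\<^sup>3\<close> that interpolates the data at the nodes \<open>0\<close> and \<open>1\<close>.\<close>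

lemma hermite_recurrence_cubic:
  fixes u p :: "nat \<Rightarrow> real"
  assumes "u 0 = 0" "p 0 = 0"
    and simpson: "\<And>n. Suc (Suc n) \<le> N \<Longrightarrow>
      p n + 4 * p (Suc n) + p (Suc (Suc n)) = 3 * (u (Suc (Suc n)) - u n)"
    and balance: "\<And>n. Suc (Suc n) \<le> N \<Longrightarrow>
      p (Suc (Suc n)) - p n = 2 * (u (Suc (Suc n)) - 2 * u (Suc n) + u n)"
    and "n \<le> N"
  shows "u n = (3 * u 1 - p 1) * real n ^ 2 + (p 1 - 2 * u 1) * real n ^ 3 \<and>
     p n = 2 * (3 * u 1 - p 1) * real n + 3 * (p 1 - 2 * u 1) * real n ^ 2"
  using assms(5)
proof (induction n rule: induct_nat_012)
  case (ge2 n)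
  define a b where "a = 3 * u 1 - p 1" and "b = p 1 - 2 * u 1"
  define r where "r = real n"
  have r: "real (Suc n) = r + 1" "real (Suc (Suc n)) = r + 2"
    by (simp_all add: r_def)
  have un: "u n = a * r ^ 2 + b * r ^ 3" "p n = 2 * a * r + 3 * b * r ^ 2"
    "u (Suc n) = a * (r + 1) ^ 2 + b * (r + 1) ^ 3"
    "p (Suc n) = 2 * a * (r + 1) + 3 * b * (r + 1) ^ 2"
    using ge2 unfolding a_def [symmetric] b_def [symmetric] r r_def [symmetric] by auto
  \<comment> \<open>Eliminating the new slope, respectively the new value, from the two stencils.\<close>
  have "u (Suc (Suc n)) = 2 * p n + 4 * p (Suc n) + 5 * u n - 4 * u (Suc n)"
    "p (Suc (Suc n)) = 5 * p n + 8 * p (Suc n) + 12 * u n - 12 * u (Suc n)"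
    using simpson [OF ge2.prems] balance [OF ge2.prems] by simp_all
  then show ?case
    unfolding a_def [symmetric] b_def [symmetric] r un
    by (simp add: algebra_simps power2_eq_square power3_eq_cube)
qed (use assms(1,2) in auto)

lemma mesh_pos: "N \<ge> 2 \<Longrightarrow> mesh N > 0"
  by (simp add: mesh_def)

lemma discrete_biharmonic_null:
  assumes N: "N \<ge> 2" and u: "u \<in> l2h0 N" and p: "hermitian_pair N u p"
    and null: "\<And>j. j \<in> {1..N - 1} \<Longrightarrow> delta_x N p j = delta_x2 N u j"
  shows "u n = 0"
proof -
  define h where "h = mesh N"
  have h: "h > 0" using mesh_pos [OF N] by (simp add: h_def)
  have u0: "u 0 = 0" and uN: "\<And>j. j \<ge> N \<Longrightarrow> u j = 0"
    using u by (auto simp: l2h0_def)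
  have p0: "p 0 = 0" "p N = 0"
    using p by (auto simp: l2h0_def hermitian_pair_def)
  have cubic: "u n = (3 * u 1 - h * p 1) * real n ^ 2 + (h * p 1 - 2 * u 1) * real n ^ 3 \<and>
     h * p n = 2 * (3 * u 1 - h * p 1) * real n + 3 * (h * p 1 - 2 * u 1) * real n ^ 2"
    if "n \<le> N" for n
  proof (rule hermite_recurrence_cubic [where N = N])
    fix n assume n: "Suc (Suc n) \<le> N"
    have "1/6 * p n + 2/3 * p (Suc n) + 1/6 * p (Suc (Suc n)) = (u (Suc (Suc n)) - u n) / (2 * h)"
      using p n by (auto simp: hermitian_pair_def delta_x_def h_def dest!: bspec [of _ _ "Suc n"])
    then show "h * p n + 4 * (h * p (Suc n)) + h * p (Suc (Suc n)) = 3 * (u (Suc (Suc n)) - u n)"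
      using h by (simp add: field_simps)
    have "(p (Suc (Suc n)) - p n) / (2 * h) = (u (Suc (Suc n)) - 2 * u (Suc n) + u n) / h\<^sup>2"
      using null [of "Suc n"] n by (simp add: delta_x_def delta_x2_def h_def)
    then have "h\<^sup>2 * ((p (Suc (Suc n)) - p n) / (2 * h)) = u (Suc (Suc n)) - 2 * u (Suc n) + u n"
      using h by simp
    moreover have "h\<^sup>2 * ((p (Suc (Suc n)) - p n) / (2 * h)) = h * (p (Suc (Suc n)) - p n) / 2"
      using h by (simp add: power2_eq_square)
    ultimately show "h * p (Suc (Suc n)) - h * p n = 2 * (u (Suc (Suc n)) - 2 * u (Suc n) + u n)"
      by (simp add: right_diff_distrib)
  qed (use u0 p0 that in auto)
  define a b where "a = 3 * u 1 - h * p 1" and "b = h * p 1 - 2 * u 1"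
  have "real N ^ 2 * (a + b * real N) = 0" "real N * (2 * a + 3 * (b * real N)) = 0"
    using cubic [of N] uN [of N] p0(2)
    unfolding a_def [symmetric] b_def [symmetric]
    by (simp_all add: algebra_simps power2_eq_square power3_eq_cube)
  then have "a + b * real N = 0" "2 * a + 3 * (b * real N) = 0"
    using N by auto
  then have "a = 0" "b * real N = 0"
    by linarith+
  then have "a = 0" "b = 0"
    using N by auto
  then show ?thesis
    using cubic [of n] uN [of n] unfolding a_def [symmetric] b_def [symmetric]
    by (cases "n \<le> N") auto
qed

lemma delta_x_diff: "delta_x N (\<lambda>n. u n - v n) j = delta_x N u j - delta_x N v j"
  by (simp add: delta_x_def diff_divide_distrib)

lemma delta_x2_diff: "delta_x2 N (\<lambda>n. u n - v n) j = delta_x2 N u j - delta_x2 N v j"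
  by (simp add: delta_x2_def diff_divide_distrib add_divide_distrib)

lemma hermitian_pair_diff:
  assumes "hermitian_pair N u p" "hermitian_pair N v q"
  shows "hermitian_pair N (\<lambda>n. u n - v n) (\<lambda>n. p n - q n)"
  unfolding hermitian_pair_def
proof (intro conjI ballI)
  show "(\<lambda>n. p n - q n) \<in> l2h0 N"
    using assms by (simp add: hermitian_pair_def l2h0_def)
  fix j assume "j \<in> {1..N - 1}"
  with assms have "1/6 * p (j - 1) + 2/3 * p j + 1/6 * p (j + 1) = delta_x N u j"
    "1/6 * q (j - 1) + 2/3 * q j + 1/6 * q (j + 1) = delta_x N v j"
    by (auto simp only: hermitian_pair_def)
  then show "1/6 * (p (j - 1) - q (j - 1)) + 2/3 * (p j - q j) + 1/6 * (p (j + 1) - q (j + 1))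
      = delta_x N (\<lambda>n. u n - v n) j"
    unfolding delta_x_diff by argo
qed

lemma inj_on_delta_x4:
  assumes "N \<ge> 2"
  shows "inj_on (delta_x4 N) (l2h0 N)"
proof (rule inj_onI)
  fix u v assume uv: "u \<in> l2h0 N" "v \<in> l2h0 N" and eq: "delta_x4 N u = delta_x4 N v"
  let ?p = "hermitian_deriv N u" and ?q = "hermitian_deriv N v"
  have "u n - v n = 0" for n
  proof (rule discrete_biharmonic_null [OF assms])
    show "(\<lambda>n. u n - v n) \<in> l2h0 N"
      using uv by (auto simp: l2h0_def)
    show "hermitian_pair N (\<lambda>n. u n - v n) (\<lambda>n. ?p n - ?q n)"
      by (intro hermitian_pair_diff hermitian_pair_hermitian_deriv assms)
    show "delta_x N (\<lambda>n. ?p n - ?q n) j = delta_x2 N (\<lambda>n. u n - v n) j" if "j \<in> {1..N - 1}" for j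
      using fun_cong [OF eq, of j] that mesh_pos [OF assms]
      by (simp add: delta_x4_def delta_x_diff delta_x2_diff)
  qed
  then show "u = v"
    by auto
qed

section \<open>Superposition of kernel columns\<close>

lemma delta_x_sum: "delta_x N (\<lambda>n. \<Sum>j\<in>J. c j * v j n) i = (\<Sum>j\<in>J. c j * delta_x N (v j) i)"
  by (simp add: delta_x_def sum_subtractf [symmetric] sum_divide_distrib algebra_simps)

lemma delta_x2_sum: "delta_x2 N (\<lambda>n. \<Sum>j\<in>J. c j * v j n) i = (\<Sum>j\<in>J. c j * delta_x2 N (v j) i)"
  by (simp add: delta_x2_def sum_subtractf [symmetric] sum.distrib [symmetric] sum_divide_distrib
      sum_distrib_left algebra_simps)

text \<open>Here \<open>m\<close> is the signed number of cells between the knot and the centre of the stencil. For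
  \<open>m \<noteq> 0\<close> the three nodes lie on one polynomial piece, where both stencils are exact. For \<open>m = 0\<close> only
  the right node contributes: Simpson's rule still holds, and the two approximations of the second
  derivative are \<open>h / 4\<close> and \<open>h / 6\<close>.\<close>

lemma truncated_cube_stencils:
  fixes h :: real and m :: int
  assumes "h > 0"
  defines "t \<equiv> \<lambda>k::int. (max 0 (real_of_int k * h)) ^ 3 / 6"
    and "s \<equiv> \<lambda>k::int. (max 0 (real_of_int k * h)) ^ 2 / 2"
  shows "1/6 * s (m - 1) + 2/3 * s m + 1/6 * s (m + 1) = (t (m + 1) - t (m - 1)) / (2 * h)" (is ?A)
    and "(s (m + 1) - s (m - 1)) / (2 * h) - (t (m + 1) - 2 * t m + t (m - 1)) / h\<^sup>2 =
      (if m = 0 then h / 12 else 0)" (is ?B)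
proof -
  consider "m \<le> - 1" | "m = 0" | "m \<ge> 1" by linarith
  then have "?A \<and> ?B"
  proof cases
    case 1
    then have "real_of_int k * h \<le> 0" if "k \<in> {m - 1, m, m + 1}" for k
      using assms(1) that by (intro mult_nonpos_nonneg) auto
    then have "max 0 (real_of_int k * h) = 0" if "k \<in> {m - 1, m, m + 1}" for k
      using that by (intro max_absorb1)
    then have "max 0 (real_of_int (m - 1) * h) = 0" "max 0 (real_of_int m * h) = 0"
      "max 0 (real_of_int (m + 1) * h) = 0"
      by blast+
    with 1 show ?thesis
      unfolding t_def s_def by (simp only: if_False) simp
  next
    case 2
    have "max 0 h = h" "max 0 (- h) = 0"
      using assms(1) by auto
    with 2 assms(1) show ?thesis
      unfolding t_def s_def by (simp add: field_simps power2_eq_square power3_eq_cube)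
  next
    case 3
    then have "max 0 (real_of_int k * h) = real_of_int k * h" if "k \<in> {m - 1, m, m + 1}" for k
      using assms(1) that by (intro max_absorb2 mult_nonneg_nonneg) auto
    then have "max 0 (real_of_int (m - 1) * h) = (real_of_int m - 1) * h"
      "max 0 (real_of_int m * h) = real_of_int m * h"
      "max 0 (real_of_int (m + 1) * h) = (real_of_int m + 1) * h"
      by (metis insertCI of_int_diff of_int_add of_int_1)+
    with 3 assms(1) show ?thesis
      unfolding t_def s_def by (simp add: field_simps power2_eq_square power3_eq_cube)
  qed
  then show ?A ?B by auto
qed

lemma cubic_stencils:
  fixes a b h x :: real
  assumes "h > 0"
  defines "t \<equiv> \<lambda>x. a * x\<^sup>2 - b * x ^ 3" and "s \<equiv> \<lambda>x. 2 * a * x - 3 * b * x\<^sup>2"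
  shows "1/6 * s (x - h) + 2/3 * s x + 1/6 * s (x + h) = (t (x + h) - t (x - h)) / (2 * h)"
    and "(s (x + h) - s (x - h)) / (2 * h) - (t (x + h) - 2 * t x + t (x - h)) / h\<^sup>2 = 0"
  using assms(1) unfolding t_def s_def
  by (simp_all add: field_simps power2_eq_square power3_eq_cube)

lemma clamped_kernel_column_stencils:
  fixes N i j :: nat
  assumes N: "N \<ge> 2" and i: "i \<in> {1..N - 1}"
  defines "v \<equiv> \<lambda>n. clamped_kernel (gridpt N n) (gridpt N j)"
    and "p \<equiv> \<lambda>n. clamped_kernel_dx (gridpt N n) (gridpt N j)"
  shows "1/6 * p (i - 1) + 2/3 * p i + 1/6 * p (i + 1) = delta_x N v i"
    and "delta_x N p i - delta_x2 N v i = (if i = j then mesh N / 12 else 0)"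
proof -
  define h where "h = mesh N"
  have h: "h > 0" using mesh_pos [OF N] by (simp add: h_def)
  define y where "y = gridpt N j"
  define x where "x = gridpt N i"
  define m where "m = int i - int j"
  define a where "a = (1 - y)\<^sup>2 * y / 2"
  define b where "b = (1 - y)\<^sup>2 * (1 + 2 * y) / 6"
  have x: "gridpt N (i - 1) = x - h" "gridpt N (i + 1) = x + h"
    using i by (auto simp: gridpt_def x_def h_def of_nat_diff algebra_simps)
  have xy: "x - y = real_of_int m * h" "x - h - y = real_of_int (m - 1) * h"
      "x + h - y = real_of_int (m + 1) * h"
    by (simp_all add: x_def y_def m_def gridpt_def h_def algebra_simps)
  note A = truncated_cube_stencils [OF h, of m] cubic_stencils [OF h, of a x b]
  have m0: "m = 0 \<longleftrightarrow> i = j" by (auto simp: m_def)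
  have v: "v (i - 1) = a * (x - h)\<^sup>2 - b * (x - h) ^ 3 + (max 0 (real_of_int (m - 1) * h)) ^ 3 / 6"
    "v i = a * x\<^sup>2 - b * x ^ 3 + (max 0 (real_of_int m * h)) ^ 3 / 6"
    "v (i + 1) = a * (x + h)\<^sup>2 - b * (x + h) ^ 3 + (max 0 (real_of_int (m + 1) * h)) ^ 3 / 6"
    unfolding v_def x y_def [symmetric] clamped_kernel_split x_def [symmetric] xy a_def b_def
    by simp_all
  have p: "p (i - 1) = 2 * a * (x - h) - 3 * b * (x - h)\<^sup>2 + (max 0 (real_of_int (m - 1) * h))\<^sup>2 / 2"
    "p i = 2 * a * x - 3 * b * x\<^sup>2 + (max 0 (real_of_int m * h))\<^sup>2 / 2"
    "p (i + 1) = 2 * a * (x + h) - 3 * b * (x + h)\<^sup>2 + (max 0 (real_of_int (m + 1) * h))\<^sup>2 / 2"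
    unfolding p_def x y_def [symmetric] clamped_kernel_dx_def x_def [symmetric] xy a_def b_def
    by simp_all
  show "1/6 * p (i - 1) + 2/3 * p i + 1/6 * p (i + 1) = delta_x N v i"
    using A(1,3) unfolding delta_x_def h_def [symmetric] v p
    by (simp only: diff_divide_distrib add_divide_distrib) argo
  show "delta_x N p i - delta_x2 N v i = (if i = j then mesh N / 12 else 0)"
    using A(2,4) unfolding delta_x_def delta_x2_def h_def [symmetric] v p m0
    by (simp only: diff_divide_distrib add_divide_distrib distrib_left)
qed

text \<open>Summing the columns with weights \<open>h f\<^sub>j\<close>, the factor \<open>12 / h\<^sup>2\<close> of the operator turns the residual
  \<open>h / 12\<close> of the column at its knot into the weight \<open>1\<close> of \<open>f\<^sub>j\<close>.\<close>

lemma delta_x4_kernel_sum: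
  assumes N: "N \<ge> 2" and f: "f \<in> l2h0 N"
  defines "u \<equiv> \<lambda>i. if i \<in> {1..N - 1} then (\<Sum>j=1..N - 1. Kh N i j * f j) else 0"
  shows "u \<in> l2h0 N" "delta_x4 N u = f"
proof -
  let ?J = "{1..N - 1}"
  define h where "h = mesh N"
  have h: "h > 0" using mesh_pos [OF N] by (simp add: h_def)
  define v where "v j n = clamped_kernel (gridpt N n) (gridpt N j)" for j n
  define w where "w j n = clamped_kernel_dx (gridpt N n) (gridpt N j)" for j n
  define V where "V = (\<lambda>n. \<Sum>j\<in>?J. (h * f j) * v j n)"
  define W where "W = (\<lambda>n. \<Sum>j\<in>?J. (h * f j) * w j n)"
  \<comment> \<open>The sums \<open>V\<close> and \<open>W\<close> need not vanish beyond \<open>N\<close>, so the grid functions are their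
    truncations; stencils centred at inner nodes reach only the nodes up to \<open>N\<close>.\<close>
  define p where "p n = (if n < N then W n else 0)" for n
  show "u \<in> l2h0 N"
    using N by (auto simp: u_def l2h0_def)
  have ends: "gridpt N 0 = 0" "gridpt N N = 1"
    using N by (simp_all add: gridpt_def mesh_def)
  have inner: "0 \<le> gridpt N j" "gridpt N j \<le> 1" if "j \<in> ?J" for j
    using that by (auto simp: gridpt_def mesh_def)
  have zero: "V 0 = 0" "V N = 0" "W 0 = 0" "W N = 0"
    by (auto simp: V_def W_def v_def w_def ends clamped_kernel_boundary inner intro!: sum.neutral)
  have u: "u n = V n" if "n \<le> N" for n
  proof (cases "n \<in> ?J")
    case True
    then show ?thesis
      by (simp add: u_def V_def v_def Kh_def h_def mult_ac)
  next
    case False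
    then have "n = 0 \<or> n = N" using that by auto
    with zero False show ?thesis by (auto simp: u_def)
  qed
  have p: "p n = W n" if "n \<le> N" for n
    using that zero by (auto simp: p_def le_less)
  have stencils: "delta_x N u i = delta_x N V i" "delta_x2 N u i = delta_x2 N V i"
    "delta_x N p i = delta_x N W i" if "i \<in> ?J" for i
  proof -
    have "i + 1 \<le> N" "i - 1 \<le> N" "i \<le> N"
      using that by auto
    then show "delta_x N u i = delta_x N V i" "delta_x2 N u i = delta_x2 N V i"
      "delta_x N p i = delta_x N W i"
      unfolding delta_x_def delta_x2_def by (simp_all only: u p)
  qed
  have "1/6 * p (i - 1) + 2/3 * p i + 1/6 * p (i + 1) = delta_x N u i" if i: "i \<in> ?J" for i
  proof -
    have "i + 1 \<le> N" "i - 1 \<le> N" "i \<le> N"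
      using that by auto
    then have "1/6 * p (i - 1) + 2/3 * p i + 1/6 * p (i + 1) =
        1/6 * W (i - 1) + 2/3 * W i + 1/6 * W (i + 1)"
      by (simp only: p)
    also have "\<dots> = (\<Sum>j\<in>?J. (h * f j) * (1/6 * w j (i - 1) + 2/3 * w j i + 1/6 * w j (i + 1)))"
      by (simp add: W_def sum_distrib_left sum.distrib algebra_simps)
    also have "\<dots> = (\<Sum>j\<in>?J. (h * f j) * delta_x N (v j) i)"
      using clamped_kernel_column_stencils(1) [OF N i] by (simp add: v_def [abs_def] w_def [abs_def])
    also have "\<dots> = delta_x N u i"
      using stencils(1) [OF i] by (simp add: V_def delta_x_sum)
    finally show ?thesis .
  qed
  moreover have "p \<in> l2h0 N"
    using zero N by (auto simp: l2h0_def p_def)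
  ultimately have "hermitian_pair N u p"
    by (simp add: hermitian_pair_def)
  then have deriv: "hermitian_deriv N u = p"
    by (rule hermitian_deriv_eq [OF N])
  show "delta_x4 N u = f"
  proof
    fix i
    show "delta_x4 N u i = f i"
    proof (cases "i \<in> ?J")
      case True
      have "delta_x N p i - delta_x2 N u i =
          (\<Sum>j\<in>?J. (h * f j) * (delta_x N (w j) i - delta_x2 N (v j) i))"
        using stencils [OF True]
        by (simp add: V_def W_def delta_x_sum delta_x2_sum sum_subtractf right_diff_distrib)
      also have "\<dots> = (\<Sum>j\<in>?J. (h * f j) * (if i = j then h / 12 else 0))"
        using clamped_kernel_column_stencils(2) [OF N True]
        by (simp only: v_def [abs_def] w_def [abs_def] h_def)
      also have "\<dots> = h\<^sup>2 / 12 * f i"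
        using True by (simp add: if_distrib sum.delta' power2_eq_square cong: if_cong)
      finally have "delta_x N p i - delta_x2 N u i = h\<^sup>2 / 12 * f i" .
      then have "12 / h\<^sup>2 * (delta_x N p i - delta_x2 N u i) = f i"
        using h by (simp only:) simp
      then show ?thesis
        using True by (simp add: delta_x4_def deriv h_def [symmetric])
    next
      case False
      then have "i = 0 \<or> i \<ge> N" by auto
      with f False show ?thesis
        by (auto simp: delta_x4_def l2h0_def)
    qed
  qed
qed

theorem corollary6p2:
  fixes N :: nat
  assumes "N \<ge> 2"
  shows "is_resolvent_kernel clamped_kernel \<and>
    bij_betw (delta_x4 N) (l2h0 N) (l2h0 N) \<and>
    (\<forall>f\<in>l2h0 N. \<forall>i\<in>{1..N - 1}.
       inv_into (l2h0 N) (delta_x4 N) f i = (\<Sum>j=1..N - 1. Kh N i j * f j)) \<and>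
    (\<forall>f\<in>l2h0 N. \<forall>u\<in>l2h0 N. delta_x4 N u = f \<longrightarrow>
       (\<forall>i\<in>{1..N - 1}. u i = (\<Sum>j=1..N - 1. Kh N i j * f j)))"
proof -
  note inj = inj_on_delta_x4 [OF assms]
  have "delta_x4 N ` l2h0 N = l2h0 N"
  proof
    show "delta_x4 N ` l2h0 N \<subseteq> l2h0 N"
      using assms by (auto simp: delta_x4_def l2h0_def)
    show "l2h0 N \<subseteq> delta_x4 N ` l2h0 N"
    proof
      fix f assume "f \<in> l2h0 N"
      from delta_x4_kernel_sum [OF assms this] show "f \<in> delta_x4 N ` l2h0 N"
        by (intro image_eqI [OF sym])
    qed
  qed
  then have bij: "bij_betw (delta_x4 N) (l2h0 N) (l2h0 N)"
    using inj by (intro bij_betw_imageI)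
  have solution: "u i = (\<Sum>j=1..N - 1. Kh N i j * f j)"
    if "f \<in> l2h0 N" "u \<in> l2h0 N" "delta_x4 N u = f" "i \<in> {1..N - 1}" for f u i
  proof -
    have "u = (\<lambda>i. if i \<in> {1..N - 1} then (\<Sum>j=1..N - 1. Kh N i j * f j) else 0)"
      by (rule inj_onD [OF inj])
        (simp_all only: that(2,3) delta_x4_kernel_sum [OF assms that(1)])
    then show ?thesis
      using that(4) by simp
  qed
  have inverse: "inv_into (l2h0 N) (delta_x4 N) f i = (\<Sum>j=1..N - 1. Kh N i j * f j)"
    if "f \<in> l2h0 N" "i \<in> {1..N - 1}" for f i
    using that bij_betw_apply [OF bij_betw_inv_into [OF bij]] bij_betw_inv_into_right [OF bij]
    by (intro solution)
  show ?thesis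
    using clamped_kernel_is_resolvent_kernel bij inverse solution
    by (intro conjI ballI impI)
qed

end
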